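(* Let $\mathcal G(A)=(\mathcal V,\mathcal E)$, $\mathcal V=[n]$, be a connected undirected network associated with a doubly stochastic matrix $A\in\mathbb R^{n\times n}$, such that no agent is adjacent to all other agents, i.e. $\mathcal N_v\cup\{v\}\neq\mathcal V$ for every $v\in\mathcal V$. Let $T\ge1$ be a finite integer. Let $\tilde x^{(0)}\in\mathbb R^n$ be the vector of private initial states, and let the agents inject private noises $\eta^{(0)},\dots,\eta^{(T-1)}\in\mathbb R^n$ and remove the accumulated noise at time $T$ by setting $\eta^{(T)}=-\sum_{k=0}^{T-1}\eta^{(k)}$ (so $\eta^{(1)}=-\eta^{(0)}$ if $T=1$), with $\eta^{(k)}=0$ for $k>T$. The shared states evolve as $$x^{(0)}=\tilde x^{(0)}+\eta^{(0)},\qquad x^{(k+1)}=Ax^{(k)}+\eta^{(k+1)},\quad k\ge0.$$ Let $u,v\in\mathcal V$ with $u\ne v$. If either (i) $v\notin\mathcal N_u$, or (ii) $v\in\mathcal N_u$ and $v$ has at least one neighbor outside $\mathcal N_u\cup\{u\}$, then agent $u$ cannot uniquely determine the private initial state $\tilde x_v^{(0)}$.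
   Context: $\mathcal G(A)$ is the graph on $[n]$ with edge set $\{(i,j):A_{ij}\ne0\}$; undirected means $A_{ij}\neq0$ if and only if $A_{ji}\ne0$. $\mathcal N_v$ denotes the set of neighbors of $v$ other than $v$ itself. Doubly stochastic means nonnegative entries with all row and column sums equal to $1$. Information available to agent $u$: it knows the matrix $A$, $T$ and the noise-removal rule; it observes the shared states $x_j^{(k)}$ for all $j\in\mathcal N_u\cup\{u\}$ and all $k\ge0$, and it knows its own noise values $\eta_u^{(k)}$ for all $k\ge 0$. "Agent $u$ cannot uniquely determine $\tilde x_v^{(0)}$" means: for every choice of private initial states and noises $(\tilde x^{(0)},\eta^{(0)},\dots,\eta^{(T-1)})$ there is another choice, giving exactly the same information to agent $u$, in which the private initial state of agent $v$ is different. *)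

theory Defs
  imports
    "HOL-Analysis.Analysis"
    "Graph_Theory.Pair_Digraph"
    "Graph_Theory.Digraph_Component"
begin

text \<open>Self-loops are allowed: \<open>(i, i)\<close> is an edge whenever \<open>A $ i $ i \<noteq> 0\<close>.\<close>

definition matrix_graph :: "real ^ 'n ^ 'n \<Rightarrow> 'n pair_pre_digraph" where
  "matrix_graph A = \<lparr>pverts = UNIV, parcs = {(i, j). A $ i $ j \<noteq> 0}\<rparr>"

definition neighbors :: "real ^ 'n ^ 'n \<Rightarrow> 'n \<Rightarrow> 'n set" where
  "neighbors A v = {w. w \<noteq> v \<and> (v, w) \<in> parcs (matrix_graph A)}"

definition doubly_stochastic :: "real ^ 'n ^ 'n \<Rightarrow> bool" where
  "doubly_stochastic A \<longleftrightarrow>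
     (\<forall>i j. 0 \<le> A $ i $ j) \<and> (\<forall>i. (\<Sum>j\<in>UNIV. A $ i $ j) = 1) \<and> (\<forall>j. (\<Sum>i\<in>UNIV. A $ i $ j) = 1)"

text \<open>
  Only the values \<open>\<eta> 0, \<dots>, \<eta> (T - 1)\<close> of the sequence \<open>\<eta>\<close> are free noise choices;
  the values from time \<open>T\<close> on are overridden by the noise-removal rule.
\<close>

definition injected_noise :: "nat \<Rightarrow> (nat \<Rightarrow> real ^ 'n) \<Rightarrow> nat \<Rightarrow> real ^ 'n" where
  "injected_noise T \<eta> k =
     (if k < T then \<eta> k else if k = T then - (\<Sum>i<T. \<eta> i) else 0)"

primrec shared_state ::
  "real ^ 'n ^ 'n \<Rightarrow> nat \<Rightarrow> real ^ 'n \<Rightarrow> (nat \<Rightarrow> real ^ 'n) \<Rightarrow> nat \<Rightarrow> real ^ 'n" where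
  "shared_state A T x0 \<eta> 0 = x0 + injected_noise T \<eta> 0"
| "shared_state A T x0 \<eta> (Suc k) = A *v shared_state A T x0 \<eta> k + injected_noise T \<eta> (Suc k)"

text \<open>
  The matrix \<open>A\<close>, the time \<open>T\<close> and the noise-removal rule are known to every agent, so they are
  the same in both scenarios.
\<close>

definition same_information ::
  "real ^ 'n ^ 'n \<Rightarrow> nat \<Rightarrow> 'n \<Rightarrow> real ^ 'n \<Rightarrow> (nat \<Rightarrow> real ^ 'n) \<Rightarrow>
     real ^ 'n \<Rightarrow> (nat \<Rightarrow> real ^ 'n) \<Rightarrow> bool" where
  "same_information A T u x0 \<eta> x0' \<eta>' \<longleftrightarrow>
     (\<forall>k. \<forall>j \<in> neighbors A u \<union> {u}.
        shared_state A T x0 \<eta> k $ j = shared_state A T x0' \<eta>' k $ j) \<and>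
     (\<forall>k. injected_noise T \<eta> k $ u = injected_noise T \<eta>' k $ u)"

definition cannot_determine :: "real ^ 'n ^ 'n \<Rightarrow> nat \<Rightarrow> 'n \<Rightarrow> 'n \<Rightarrow> bool" where
  "cannot_determine A T u v \<longleftrightarrow>
     (\<forall>x0 \<eta>. \<exists>x0' \<eta>'. same_information A T u x0 \<eta> x0' \<eta>' \<and> x0' $ v \<noteq> x0 $ v)"

end

theory Submission
  imports Defs
begin

text \<open>
  Let \<open>w\<close> be an agent invisible to \<open>u\<close>. Adding \<open>(I - A) e\<^sub>w\<close> to the private initial state and
  compensating with the noises \<open>A e\<^sub>w\<close> at time \<open>0\<close> and \<open>- A e\<^sub>w\<close> at time \<open>1\<close> changes the shared
  states only at time \<open>0\<close> and only at \<open>w\<close>; the added noise sums to zero, so it is consistent with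
  the removal rule, and its \<open>u\<close>-entry \<open>\<plusminus> A\<^sub>u\<^sub>w\<close> vanishes. It remains to find such a \<open>w\<close> for which the
  \<open>v\<close>-entry of \<open>(I - A) e\<^sub>w\<close> is nonzero: \<open>w = v\<close> if \<open>v\<close> is invisible to \<open>u\<close>, since \<open>A\<^sub>v\<^sub>v < 1\<close> by
  connectedness, and otherwise any invisible neighbor \<open>w\<close> of \<open>v\<close>.
\<close>

text \<open>For \<open>T \<ge> 2\<close> the two changes cancel in the removal sum. For
  \<open>T = 1\<close> the update at time 1 is overridden, but the removal rule itself supplies
  \<open>- d\<close>.\<close>

lemma injected_noise_compensated:
  assumes "T \<ge> 1"
  shows "injected_noise T (\<eta>(0 := \<eta> 0 + d, 1 := \<eta> 1 - d)) k =
    injected_noise T \<eta> k + (if k = 0 then d else if k = 1 then - d else 0)"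
proof -
  let ?\<eta>' = "\<eta>(0 := \<eta> 0 + d, 1 := \<eta> 1 - d)"
  have "(\<Sum>i<T. ?\<eta>' i) = (\<Sum>i<T. \<eta> i) + (if T = 1 then d else 0)"
  proof (cases "T = 1")
    case False
    with assms have "T = Suc (Suc (T - 2))"
      by linarith
    then obtain m where T: "T = Suc (Suc m)" ..
    show ?thesis
      unfolding T by (simp add: sum.lessThan_Suc_shift del: sum.lessThan_Suc)
  qed simp
  with assms show ?thesis
    by (auto simp: injected_noise_def)
qed

lemma shared_state_compensated:
  assumes "T \<ge> 1"
  shows "shared_state A T (x0 + (e - A *v e)) (\<eta>(0 := \<eta> 0 + A *v e, 1 := \<eta> 1 - A *v e)) k =
    shared_state A T x0 \<eta> k + (if k = 0 then e else 0)"
proof (induction k)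
  case 0
  show ?case
    by (simp only: shared_state.simps injected_noise_compensated[OF assms]) simp
next
  case (Suc k)
  \<comment> \<open>For \<open>k = 0\<close> the surplus \<open>e\<close> propagates to
    \<open>A *v e\<close>, which the noise at time 1 cancels.\<close>
  show ?case
    by (simp only: shared_state.simps injected_noise_compensated[OF assms] Suc.IH)
      (simp add: matrix_vector_right_distrib)
qed

lemma cannot_determine_if_invisible:
  fixes A :: "real ^ 'n ^ 'n"
  assumes "T \<ge> 1" and w: "w \<notin> neighbors A u \<union> {u}"
    and v: "(axis w 1 - A *v axis w 1) $ v \<noteq> 0"
  shows "cannot_determine A T u v"
  unfolding cannot_determine_def
proof (intro allI)
  fix x0 :: "real ^ 'n" and \<eta> :: "nat \<Rightarrow> real ^ 'n"
  let ?e = "axis w 1 :: real ^ 'n"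
  let ?x0' = "x0 + (?e - A *v ?e)"
  let ?\<eta>' = "\<eta>(0 := \<eta> 0 + A *v ?e, 1 := \<eta> 1 - A *v ?e)"
  have "(A *v ?e) $ u = 0"
    using w by (auto simp: neighbors_def matrix_graph_def matrix_vector_mul_component
        inner_axis)
  then have "injected_noise T ?\<eta>' k $ u = injected_noise T \<eta> k $ u" for k
    by (simp only: injected_noise_compensated[OF assms(1)]) simp
  moreover have "shared_state A T ?x0' ?\<eta>' k $ j = shared_state A T x0 \<eta> k $ j"
    if "j \<in> neighbors A u \<union> {u}" for j k
  proof -
    have "j \<noteq> w"
      using that w by blast
    then have "?e $ j = 0"
      by (simp add: axis_def)
    then show ?thesis
      by (simp only: shared_state_compensated[OF assms(1)]) simp
  qed
  ultimately have "same_information A T u x0 \<eta> ?x0' ?\<eta>'"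
    unfolding same_information_def by metis
  moreover have "?x0' $ v \<noteq> x0 $ v"
    using v by simp
  ultimately show "\<exists>x0' \<eta>'. same_information A T u x0 \<eta> x0' \<eta>' \<and> x0' $ v \<noteq> x0 $ v"
    by blast
qed

lemma connected_imp_neighbor:
  fixes A :: "real ^ 'n ^ 'n"
  assumes "symmetric (with_proj (matrix_graph A))"
    and "Digraph_Component.connected (with_proj (matrix_graph A))"
    and "u \<noteq> v"
  shows "neighbors A v \<noteq> {}"
proof
  assume empty: "neighbors A v = {}"
  interpret pair_wf_digraph "matrix_graph A"
    by unfold_locales (auto simp: matrix_graph_def)
  have "strongly_connected (with_proj (matrix_graph A))"
    using symmetric_connected_imp_strongly_connected assms by blast
  then have "v \<rightarrow>\<^sup>*\<^bsub>with_proj (matrix_graph A)\<^esub> u"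
    by (auto simp: strongly_connected_def matrix_graph_def)
  \<comment> \<open>The only possible arc out of \<open>v\<close> is a self-loop, so no walk from
    \<open>v\<close> leaves it.\<close>
  then have "u = v"
    by (induction rule: reachable_induct) (use empty in \<open>auto simp: neighbors_def\<close>)
  with assms(3) show False
    by blast
qed

text \<open>A neighbor takes a positive share of row \<open>v\<close>, whose nonnegative entries sum
  to 1.\<close>

lemma doubly_stochastic_diag_neq_1:
  assumes "doubly_stochastic A" and "w \<in> neighbors A v"
  shows "A $ v $ v \<noteq> 1"
proof -
  have nonneg: "0 \<le> A $ i $ j" and row: "(\<Sum>j\<in>UNIV. A $ i $ j) = 1" for i j
    using assms(1) by (auto simp: doubly_stochastic_def)
  have w: "w \<noteq> v" "A $ v $ w \<noteq> 0"
    using assms(2) by (auto simp: neighbors_def matrix_graph_def)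
  have "A $ v $ v + A $ v $ w = (\<Sum>j\<in>{v, w}. A $ v $ j)"
    using w by simp
  also have "\<dots> \<le> 1"
    unfolding row[of v, symmetric] by (rule sum_mono2) (use nonneg in auto)
  finally show ?thesis
    using w nonneg[of v w] by linarith
qed

theorem theorem2:
  fixes A :: "real ^ 'n ^ 'n" and T :: nat and u v :: 'n
  assumes "symmetric (with_proj (matrix_graph A))"
    and "Digraph_Component.connected (with_proj (matrix_graph A))"
    and "doubly_stochastic A"
    and "\<forall>w. neighbors A w \<union> {w} \<noteq> UNIV"
    and "T \<ge> 1"
    and "u \<noteq> v"
    and "v \<notin> neighbors A u \<or>
         (v \<in> neighbors A u \<and> (\<exists>w \<in> neighbors A v. w \<notin> neighbors A u \<union> {u}))"
  shows "cannot_determine A T u v"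
proof (cases "v \<in> neighbors A u")
  case False
  have "A $ v $ v \<noteq> 1"
    using connected_imp_neighbor[OF assms(1,2,6)] doubly_stochastic_diag_neq_1[OF assms(3)]
    by blast
  then have "(axis v 1 - A *v axis v 1) $ v \<noteq> 0"
    by (simp add: matrix_vector_mul_component inner_axis)
  with False assms(5,6) show ?thesis
    by (intro cannot_determine_if_invisible) auto
next
  case True
  then obtain w where w: "w \<in> neighbors A v" "w \<notin> neighbors A u \<union> {u}"
    using assms(7) by blast
  then have "w \<noteq> v" "A $ v $ w \<noteq> 0"
    by (auto simp: neighbors_def matrix_graph_def)
  \<comment> \<open>As \<open>w \<noteq> v\<close>, this entry is
    \<open>- A $ v $ w\<close>.\<close>
  then have "(axis w 1 - A *v axis w 1) $ v \<noteq> 0"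
    by (simp add: matrix_vector_mul_component inner_axis) (simp add: axis_def)
  with w(2) assms(5) show ?thesis
    by (intro cannot_determine_if_invisible)
qed

end
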